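(* Let $\lambda_1,\gamma_1,c_{1,\mathbf 0}\in\mathbb C$ with $\mathrm{Re}(\lambda_1)<0$ and $c_{1,\mathbf 0}\neq 0$, and consider for $\varepsilon>0$ the system of equations in $(\rho,\Omega,\psi)$ $$a(\rho)+\varepsilon\left(\mathrm{Re}(c_{1,\mathbf 0})\cos\psi+\mathrm{Im}(c_{1,\mathbf 0})\sin\psi\right)=0,\qquad (b(\rho)-\Omega)\rho+\varepsilon\left(\mathrm{Im}(c_{1,\mathbf 0})\cos\psi-\mathrm{Re}(c_{1,\mathbf 0})\sin\psi\right)=0,$$ where $a(\rho)=\mathrm{Re}(\lambda_1)\rho+\mathrm{Re}(\gamma_1)\rho^3$ and $b(\rho)=\mathrm{Im}(\lambda_1)+\mathrm{Im}(\gamma_1)\rho^2$. Assume that $\mathrm{Re}(\gamma_1)>0$ and that the cubic-order zero $\rho_1=\sqrt{|\mathrm{Re}(\lambda_1)|/\mathrm{Re}(\gamma_1)}$ of $a(\rho)$ is non-spurious. Then: (i) For $\varepsilon>0$ small enough, there exists an isola, perturbing from the damped backbone curve $\Omega=b(\rho)$, near the point $(\Omega,\rho)=(b(\rho_1),\rho_1)$ of that curve. (ii) The isola is disconnected from the main forced response curve for $\varepsilon>0$ satisfying $$\varepsilon<\frac{1}{|c_{1,\mathbf 0}|}\sqrt{\frac{4|\mathrm{Re}(\lambda_1)|^3}{27\,\mathrm{Re}(\gamma_1)}}.$$ (iii) The isola merges with the main forced response curve approximately at the value $$\varepsilon_{\mathrm m}=\frac{1}{|c_{1,\mathbf 0}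|}\sqrt{\frac{4|\mathrm{Re}(\lambda_1)|^3}{27\,\mathrm{Re}(\gamma_1)}}.$$
   Context: The equations are the fixed-point equations of the leading-order (cubic) truncation of the reduced dynamics, in polar coordinates $s_1=\rho e^{\mathrm i\theta}$, $s_2=\bar s_1$, $\psi=\theta-\Omega t$, on a two-dimensional time-periodic spectral submanifold, tangent at the origin to the eigenspace of a complex pair $\lambda_1,\bar\lambda_1$, of a periodically forced mechanical system with forcing amplitude $\varepsilon$ and frequency $\Omega$; fixed points correspond to periodic responses. The number $\gamma_1$ is the coefficient of $s_1^2s_2$ in the autonomous reduced dynamics, and $c_{1,\mathbf 0}$ is the coefficient of $\varepsilon e^{\mathrm i\Omega t}$ in $\dot s_1$. Amplitudes are $\rho\ge0$. The higher-order reduced dynamics replaces $a$ by $\mathrm{Re}(\lambda_1)\rho+\sum_{i=1}^M\mathrm{Re}(\gamma_i)\rho^{2i+1}$. A zero of a truncated $a$ is called non-spurious if it converges to a genuine zero of the full function $a$ (the sum of the Taylor series) as $M\to\infty$. The forced response curve (FRC) for fixed $\varepsilon$ is the projection to the $(\Omega,\rho)$-plane of the solution set of the equations. The main FRC is the branch perturbing from the trivial solution $\rho=0$ of the case $\varepsilon=0$. An isola is an isolated branch of the FRC, detached from the main FRC. That it perturbs from the backbone curve near an amplitude $\rho_1$ means that for small $\varepsilon>0$ it lies in a small neighborhood of $(b(\rho_1),\rho_1)$, shrinking to this point as $\varepsilon\to0$. The isola merges with the main FRC when the two branches become connected, i.e. when the maximum amplitude of the main FRC meets the minimum amplitude of the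 isola. The word "approximately" in (iii) refers to the cubic truncation as an approximation of the full dynamics; for the truncated system of equations itself the merging value is $\varepsilon_{\mathrm m}$. *)

theory Defs
  imports "HOL-Analysis.Analysis"
begin

definition a_cubic :: "complex \<Rightarrow> complex \<Rightarrow> real \<Rightarrow> real" where
  "a_cubic l g \<rho> = Re l * \<rho> + Re g * \<rho> ^ 3"

definition b_cubic :: "complex \<Rightarrow> complex \<Rightarrow> real \<Rightarrow> real" where
  "b_cubic l g \<rho> = Im l + Im g * \<rho>\<^sup>2"

text \<open>The truncations of order \<open>2 M + 1\<close> use the coefficients \<open>\<gamma> 1, \<dots>, \<gamma> M\<close>;
  the value \<open>\<gamma> 0\<close> is never used.\<close>

definition a_trunc :: "complex \<Rightarrow> (nat \<Rightarrow> complex) \<Rightarrow> nat \<Rightarrow> real \<Rightarrow> real" where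
  "a_trunc l \<gamma> M \<rho> = Re l * \<rho> + (\<Sum>i=1..M. Re (\<gamma> i) * \<rho> ^ (2 * i + 1))"

lemma a_trunc_1: "a_trunc l \<gamma> 1 \<rho> = a_cubic l (\<gamma> 1) \<rho>"
  by (simp add: a_trunc_def a_cubic_def power3_eq_cube)

definition a_full :: "complex \<Rightarrow> (nat \<Rightarrow> complex) \<Rightarrow> real \<Rightarrow> real" where
  "a_full l \<gamma> \<rho> = Re l * \<rho> + (\<Sum>i. Re (\<gamma> (Suc i)) * \<rho> ^ (2 * Suc i + 1))"

text \<open>The limit has to be a nontrivial zero, at which the series actually converges:
  \<open>\<rho> = 0\<close> is a zero of every truncation, so admitting it as a limit would make
  the notion void.\<close>

definition nonspurious_zero :: "complex \<Rightarrow> (nat \<Rightarrow> complex) \<Rightarrow> nat \<Rightarrow> real \<Rightarrow> bool" where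
  "nonspurious_zero l \<gamma> K \<rho> \<longleftrightarrow>
     (\<exists>r R. r K = \<rho> \<and> (\<forall>M\<ge>K. a_trunc l \<gamma> M (r M) = 0) \<and> r \<longlonglongrightarrow> R \<and> 0 < R \<and>
        summable (\<lambda>i. Re (\<gamma> (Suc i)) * R ^ (2 * Suc i + 1)) \<and> a_full l \<gamma> R = 0)"

definition fixed_point_eqs ::
  "complex \<Rightarrow> complex \<Rightarrow> complex \<Rightarrow> real \<Rightarrow> real \<Rightarrow> real \<Rightarrow> real \<Rightarrow> bool" where
  "fixed_point_eqs l g c \<epsilon> \<rho> \<Omega> \<psi> \<longleftrightarrow>
     a_cubic l g \<rho> + \<epsilon> * (Re c * cos \<psi> + Im c * sin \<psi>) = 0 \<and>
     (b_cubic l g \<rho> - \<Omega>) * \<rho> + \<epsilon> * (Im c * cos \<psi> - Re c * sin \<psi>) = 0"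

text \<open>Points of the response curve are pairs \<open>(\<Omega>, \<rho>)\<close>.\<close>

definition FRC :: "complex \<Rightarrow> complex \<Rightarrow> complex \<Rightarrow> real \<Rightarrow> (real \<times> real) set" where
  "FRC l g c \<epsilon> = {(\<Omega>, \<rho>). 0 \<le> \<rho> \<and> (\<exists>\<psi>. fixed_point_eqs l g c \<epsilon> \<rho> \<Omega> \<psi>)}"

text \<open>The part of the response curve at forcing \<open>\<epsilon>\<close> that perturbs from a set \<open>S\<close> of
  solutions of the unforced problem: the points reached from \<open>S\<close> by continuation of
  solutions as the forcing increases from \<open>0\<close> to \<open>\<epsilon>\<close>.\<close>

definition perturbed_branch ::
  "complex \<Rightarrow> complex \<Rightarrow> complex \<Rightarrow> (real \<times> real) set \<Rightarrow> real \<Rightarrow> (real \<times> real) set" where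
  "perturbed_branch l g c S \<epsilon> =
     {x. \<exists>p. continuous_on {0..\<epsilon>} p \<and> (\<forall>s\<in>{0..\<epsilon>}. p s \<in> FRC l g c s) \<and> p 0 \<in> S \<and> p \<epsilon> = x}"

definition main_FRC :: "complex \<Rightarrow> complex \<Rightarrow> complex \<Rightarrow> real \<Rightarrow> (real \<times> real) set" where
  "main_FRC l g c = perturbed_branch l g c {(\<Omega>, \<rho>). \<rho> = 0}"

text \<open>Continuation in \<open>\<epsilon>\<close> of the point with amplitude \<open>r\<close> on the damped backbone curve
  \<open>\<Omega> = b(\<rho>)\<close>; whether it is an isola depends on \<open>\<epsilon>\<close>.\<close>

definition backbone_branch ::
  "complex \<Rightarrow> complex \<Rightarrow> complex \<Rightarrow> real \<Rightarrow> real \<Rightarrow> (real \<times> real) set" where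
  "backbone_branch l g c r = perturbed_branch l g c {(b_cubic l g r, r)}"

definition is_isola :: "complex \<Rightarrow> complex \<Rightarrow> complex \<Rightarrow> real \<Rightarrow> (real \<times> real) set \<Rightarrow> bool" where
  "is_isola l g c \<epsilon> X \<longleftrightarrow> X \<in> components (FRC l g c \<epsilon>) \<and> X \<inter> main_FRC l g c \<epsilon> = {}"

end

theory Submission
  imports Defs
begin

text \<open>
  Eliminating \<open>\<psi>\<close> turns the equations into \<open>a(\<rho>)\<^sup>2 + ((b(\<rho>) - \<Omega>) \<rho>)\<^sup>2 = (\<epsilon> |c|)\<^sup>2\<close>.
  Put \<open>q = \<rho>\<^sub>1 / \<surd>3\<close>, so that \<open>a(\<rho>) = Re \<gamma>\<^sub>1 (\<rho>\<^sup>3 - 3 q\<^sup>2 \<rho>)\<close> falls on \<open>[0, q]\<close> to its minimum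
  \<open>-2 Re \<gamma>\<^sub>1 q\<^sup>3 = -\<epsilon>\<^sub>m |c|\<close> and rises on \<open>[q, \<infinity>)\<close> through its zero \<open>\<rho>\<^sub>1\<close>.  For \<open>\<epsilon> < \<epsilon>\<^sub>m\<close> no
  response has amplitude \<open>q\<close>, so a continuation path cannot cross this level.  Conversely, in the
  coordinates \<open>(a(\<rho>), (b(\<rho>) - \<Omega>) \<rho>)\<close> every response lies on a circle of radius \<open>\<epsilon> |c|\<close>; shrinking
  the circle radially and inverting \<open>a\<close> on \<open>[0, q]\<close> or on \<open>[q, \<infinity>)\<close> continues the response back to the
  trivial solution or to the backbone point.  So up to \<open>\<epsilon>\<^sub>m\<close> the two branches are the parts of
  the curve with \<open>\<rho> \<le> q\<close> and \<open>\<rho> \<ge> q\<close>, and together they are always the whole curve.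
\<close>

section \<open>Elimination of the phase\<close>

text \<open>In complex form the two equations say
  \<open>z = - (of_real r * c * cis (- \<psi>))\<close>. Varying the phase sweeps out the whole
  circle, so only the moduli have to agree.\<close>

lemma rotation_equations_iff:
  fixes c z :: complex and r :: real
  shows "(\<exists>\<psi>. Re z + r * (Re c * cos \<psi> + Im c * sin \<psi>) = 0 \<and>
              Im z + r * (Im c * cos \<psi> - Re c * sin \<psi>) = 0)
           \<longleftrightarrow> (Re z)\<^sup>2 + (Im z)\<^sup>2 = (r * cmod c)\<^sup>2"
proof -
  have rot: "(Re z + r * (Re c * cos \<psi> + Im c * sin \<psi>) = 0 \<and>
              Im z + r * (Im c * cos \<psi> - Re c * sin \<psi>) = 0)
              \<longleftrightarrow> z = - (of_real r * c * cis (- \<psi>))" for \<psi>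
    by (auto simp: complex_eq_iff algebra_simps)
  have "(\<exists>\<psi>. z = - (of_real r * c * cis (- \<psi>))) \<longleftrightarrow> cmod z = \<bar>r\<bar> * cmod c"
  proof
    assume "\<exists>\<psi>. z = - (of_real r * c * cis (- \<psi>))"
    then show "cmod z = \<bar>r\<bar> * cmod c"
      by (auto simp: norm_mult)
  next
    assume eq: "cmod z = \<bar>r\<bar> * cmod c"
    show "\<exists>\<psi>. z = - (of_real r * c * cis (- \<psi>))"
    proof (cases "of_real r * c = 0")
      case True
      then show ?thesis using eq by auto
    next
      case False
      define w where "w = - z / (of_real r * c)"
      have "cmod w = 1"
        using False eq by (simp add: w_def norm_divide norm_mult)
      \<comment> \<open>The double minus exhibits \<open>- Arg w\<close> as the phase.\<close>
      then have "w = cis (- (- Arg w))"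
        using rcis_cmod_Arg[of w] by (simp add: rcis_def)
      moreover have "z = - (of_real r * c * w)"
        using False by (simp add: w_def)
      ultimately show ?thesis by metis
    qed
  qed
  also have "\<dots> \<longleftrightarrow> (cmod z)\<^sup>2 = (r * cmod c)\<^sup>2"
    by (metis abs_mult abs_norm_cancel power2_eq_iff_nonneg abs_ge_zero norm_ge_zero power2_abs)
  finally show ?thesis
    by (simp only: rot cmod_power2)
qed

lemma FRC_iff:
  "(\<Omega>, \<rho>) \<in> FRC l g c \<epsilon> \<longleftrightarrow>
     0 \<le> \<rho> \<and> (a_cubic l g \<rho>)\<^sup>2 + ((b_cubic l g \<rho> - \<Omega>) * \<rho>)\<^sup>2 = (\<epsilon> * cmod c)\<^sup>2"
  using rotation_equations_iff[of "Complex (a_cubic l g \<rho>) ((b_cubic l g \<rho> - \<Omega>) * \<rho>)" \<epsilon> c]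
  by (simp add: FRC_def fixed_point_eqs_def)

lemma FRC_abs_a_le:
  assumes "x \<in> FRC l g c \<epsilon>" "0 \<le> \<epsilon>"
  shows "\<bar>a_cubic l g (snd x)\<bar> \<le> \<epsilon> * cmod c"
proof -
  have "(a_cubic l g (snd x))\<^sup>2 \<le> (\<epsilon> * cmod c)\<^sup>2"
    using assms(1) FRC_iff[of "fst x" "snd x" l g c \<epsilon>]
      zero_le_power2[of "(b_cubic l g (snd x) - fst x) * snd x"]
    by (metis le_add_same_cancel1 prod.collapse)
  then show ?thesis
    using assms(2) by (simp add: abs_le_square_iff[symmetric] abs_mult)
qed

section \<open>Continuity and continuation in the forcing\<close>

lemma continuous_on_a_cubic [continuous_intros]: "continuous_on A (a_cubic l g)"
  unfolding a_cubic_def by (intro continuous_intros)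

lemma continuous_on_b_cubic [continuous_intros]: "continuous_on A (b_cubic l g)"
  unfolding b_cubic_def by (intro continuous_intros)

lemma perturbed_branchI:
  assumes "continuous_on {0..\<epsilon>} p" "\<And>s. s \<in> {0..\<epsilon>} \<Longrightarrow> p s \<in> FRC l g c s" "p 0 \<in> S" "p \<epsilon> = x"
  shows "x \<in> perturbed_branch l g c S \<epsilon>"
  using assms unfolding perturbed_branch_def by blast

lemma perturbed_branch_subset_FRC:
  assumes "0 \<le> \<epsilon>"
  shows "perturbed_branch l g c S \<epsilon> \<subseteq> FRC l g c \<epsilon>"
proof
  fix x assume "x \<in> perturbed_branch l g c S \<epsilon>"
  then obtain p where "\<forall>s\<in>{0..\<epsilon>}. p s \<in> FRC l g c s" "p \<epsilon> = x"
    unfolding perturbed_branch_def by blast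
  moreover have "\<epsilon> \<in> {0..\<epsilon>}" using assms by simp
  ultimately show "x \<in> FRC l g c \<epsilon>" by blast
qed

section \<open>Topological tools: connected strips, lifting, components\<close>

text \<open>The circle equation fixes the distance of \<open>\<Omega>\<close> from the backbone as
  \<open>d \<rho> / \<rho>\<close>, so over \<open>J\<close> the curve consists of two graphs
  \<open>f 1\<close> and \<open>f (-1)\<close>, one on each side. Each is a continuous image of an
  interval, and they meet at the tip \<open>t\<close>, where \<open>d\<close> vanishes.\<close>

lemma connected_FRC_strip:
  assumes J: "is_interval J" "J \<subseteq> {0<..}" "\<And>\<rho>. \<rho> \<in> J \<Longrightarrow> \<bar>a_cubic l g \<rho>\<bar> \<le> \<epsilon> * cmod c"
    and tip: "t \<in> J" "\<bar>a_cubic l g t\<bar> = \<epsilon> * cmod c"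
  shows "connected {x \<in> FRC l g c \<epsilon>. snd x \<in> J}"
proof -
  define d where "d \<rho> = sqrt ((\<epsilon> * cmod c)\<^sup>2 - (a_cubic l g \<rho>)\<^sup>2)" for \<rho>
  define f where "f \<sigma> \<rho> = (b_cubic l g \<rho> + \<sigma> * d \<rho> / \<rho>, \<rho>)" for \<sigma> \<rho>
  have sq: "(a_cubic l g \<rho>)\<^sup>2 \<le> (\<epsilon> * cmod c)\<^sup>2" if "\<rho> \<in> J" for \<rho>
    using J(3)[OF that] by (simp add: abs_le_square_iff[symmetric])
  have d2: "(d \<rho>)\<^sup>2 = (\<epsilon> * cmod c)\<^sup>2 - (a_cubic l g \<rho>)\<^sup>2" if "\<rho> \<in> J" for \<rho>
    using sq[OF that] by (simp add: d_def)
  have sub: "{x \<in> FRC l g c \<epsilon>. snd x \<in> J} \<subseteq> f 1 ` J \<union> f (-1) ` J"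
  proof clarify
    fix \<Omega> \<rho> assume x: "(\<Omega>, \<rho>) \<in> FRC l g c \<epsilon>" "snd (\<Omega>, \<rho>) \<in> J" "(\<Omega>, \<rho>) \<notin> f (-1) ` J"
    then have \<rho>: "\<rho> \<in> J" "0 < \<rho>" using J(2) by auto
    have "((\<Omega> - b_cubic l g \<rho>) * \<rho>)\<^sup>2 = (d \<rho>)\<^sup>2"
      using x(1) d2[OF \<rho>(1)] by (simp add: FRC_iff power2_commute power_mult_distrib)
    then have "(\<Omega> - b_cubic l g \<rho>) * \<rho> = 1 * d \<rho> \<or> (\<Omega> - b_cubic l g \<rho>) * \<rho> = (-1) * d \<rho>"
      by (simp add: power2_eq_iff)
    then have "\<Omega> = b_cubic l g \<rho> + 1 * d \<rho> / \<rho> \<or> \<Omega> = b_cubic l g \<rho> + (-1) * d \<rho> / \<rho>"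
      using \<rho>(2) by (auto simp: field_simps)
    then show "(\<Omega>, \<rho>) \<in> f 1 ` J"
      using x(3) \<rho>(1) unfolding f_def by blast
  qed
  have sup: "f \<sigma> ` J \<subseteq> {x \<in> FRC l g c \<epsilon>. snd x \<in> J}" if "\<sigma>\<^sup>2 = 1" for \<sigma>
  proof (rule image_subsetI, rule CollectI)
    fix \<rho> assume \<rho>: "\<rho> \<in> J"
    then have "0 < \<rho>" using J(2) by auto
    then show "f \<sigma> \<rho> \<in> FRC l g c \<epsilon> \<and> snd (f \<sigma> \<rho>) \<in> J"
      using \<rho> d2[OF \<rho>] that by (simp add: f_def FRC_iff power_mult_distrib)
  qed
  have "{x \<in> FRC l g c \<epsilon>. snd x \<in> J} = f 1 ` J \<union> f (-1) ` J"
    using sub sup[of 1] sup[of "-1"] by auto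
  moreover have "connected (f \<sigma> ` J)" for \<sigma>
  proof (rule connected_continuous_image)
    show "continuous_on J (f \<sigma>)"
      unfolding f_def d_def using J(2) by (intro continuous_intros) auto
    show "connected J" using J(1) is_interval_connected_1 by blast
  qed
  moreover have "(a_cubic l g t)\<^sup>2 = (\<epsilon> * cmod c)\<^sup>2"
    using tip(2) by (metis power2_abs)
  then have "f 1 t = f (-1) t"
    by (simp add: f_def d_def)
  then have "f 1 ` J \<inter> f (-1) ` J \<noteq> {}"
    using tip(1) by (metis IntI empty_iff imageI)
  ultimately show ?thesis
    by (simp add: connected_Un)
qed

text \<open>The value \<open>s / \<epsilon> * f r1\<close> moves linearly from 0 to
  \<open>f r1\<close> and stays in the image by the intermediate value theorem; the inverse of
  \<open>f\<close>, continuous by compactness, pulls it back. Using \<open>closed_segment\<close>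
  allows \<open>r1\<close> on either side of \<open>r0\<close>.\<close>

lemma lift_through_injective:
  fixes f :: "real \<Rightarrow> real"
  assumes cont: "continuous_on (closed_segment r0 r1) f"
    and inj: "inj_on f (closed_segment r0 r1)" and "f r0 = 0" and "0 < \<epsilon>"
  obtains r where "continuous_on {0..\<epsilon>} r" "r 0 = r0" "r \<epsilon> = r1"
    "\<And>s. s \<in> {0..\<epsilon>} \<Longrightarrow> r s \<in> closed_segment r0 r1 \<and> f (r s) = s / \<epsilon> * f r1"
proof
  let ?S = "closed_segment r0 r1"
  let ?k = "the_inv_into ?S f"
  define r where "r s = ?k (s / \<epsilon> * f r1)" for s
  have im: "s / \<epsilon> * f r1 \<in> f ` ?S" if "s \<in> {0..\<epsilon>}" for s
  proof -
    have "s / \<epsilon> * f r1 \<in> closed_segment (f r0) (f r1)"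
      using that assms(3,4) by (auto simp: in_segment intro!: exI[of _ "s / \<epsilon>"])
    then show ?thesis using IVT'_closed_segment_real[OF _ cont] by force
  qed
  have "continuous_on (f ` ?S) ?k"
    using cont inj by (intro continuous_on_inv_into) auto
  then show "continuous_on {0..\<epsilon>} r"
    unfolding r_def
    by (rule continuous_on_compose2) (use im assms(4) in \<open>auto intro!: continuous_intros\<close>)
  show "r 0 = r0" "r \<epsilon> = r1"
    using the_inv_into_f_f[OF inj, of r0] the_inv_into_f_f[OF inj, of r1] assms(3,4)
    by (auto simp: r_def)
  show "r s \<in> ?S \<and> f (r s) = s / \<epsilon> * f r1" if "s \<in> {0..\<epsilon>}" for s
    using im[OF that] the_inv_into_into[OF inj _ order_refl] f_the_inv_into_f[OF inj]
    by (auto simp: r_def)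
qed

text \<open>A connected set between \<open>A\<close> and \<open>S\<close> is covered by the closed
  sets \<open>U\<close> and \<open>V\<close>, which are disjoint on it. It meets \<open>U\<close>,
  hence misses \<open>V\<close> and therefore \<open>B\<close>.\<close>

lemma component_of_separated_parts:
  assumes "S = A \<union> B" "A \<noteq> {}" "connected A" "closed U" "closed V"
    and "A \<subseteq> U" "B \<subseteq> V" "S \<inter> U \<inter> V = {}"
  shows "A \<in> components S"
  unfolding in_components_maximal
proof (intro conjI allI impI)
  fix D assume D: "D \<noteq> {} \<and> A \<subseteq> D \<and> D \<subseteq> S \<and> connected D"
  then have "D \<subseteq> U \<union> V" "U \<inter> V \<inter> D = {}" "U \<inter> D \<noteq> {}"
    using assms by auto
  then have "V \<inter> D = {}"
    using D assms(4,5) unfolding connected_closed by metis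
  then show "D = A" using D assms(1,7) by blast
qed (use assms(1-3) in simp_all)

section \<open>The cubic \<open>a\<close> around its critical point\<close>

text \<open>The condition on \<open>Re l\<close> says that the derivative
  \<open>Re l + 3 * Re g * \<rho>\<^sup>2\<close> of \<open>a\<close> vanishes at \<open>q\<close>;
  expressing \<open>Re l\<close> through \<open>q\<close> keeps most square roots out of the
  computations.\<close>

locale cubic_response =
  fixes l g c :: complex and q :: real
  assumes q: "0 < q" and g: "0 < Re g" and c: "c \<noteq> 0" and l: "Re l = - 3 * Re g * q\<^sup>2"
begin

abbreviation "a \<equiv> a_cubic l g"
abbreviation "b \<equiv> b_cubic l g"

text \<open>The forcing at which the radius \<open>\<epsilon> * cmod c\<close> equals the depth
  \<open>- a q\<close> of the minimum; this is the merging value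
  \<open>\<epsilon>\<^sub>m\<close>.\<close>

definition crit :: real where "crit = 2 * Re g * q ^ 3 / cmod c"

lemma cmod_c: "0 < cmod c"
  using c by simp

lemma crit_pos: "0 < crit"
  using q g cmod_c by (simp add: crit_def)

lemma a_eq: "a \<rho> = Re g * \<rho> * (\<rho>\<^sup>2 - 3 * q\<^sup>2)"
  by (simp add: a_cubic_def l algebra_simps power2_eq_square power3_eq_cube)

lemma a_0 [simp]: "a 0 = 0"
  by (simp add: a_eq)

text \<open>When both arguments are nonnegative and on the same side of \<open>q\<close>, comparing
  each of the three products with \<open>q\<^sup>2\<close> gives the sign of the last factor, hence
  monotonicity without derivatives.\<close>

lemma a_diff: "a y - a x = Re g * (y - x) * (x\<^sup>2 + x * y + y\<^sup>2 - 3 * q\<^sup>2)"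
  by (simp add: a_eq algebra_simps power2_eq_square)

lemma a_q: "a q = - (crit * cmod c)"
  using cmod_c by (simp add: a_eq crit_def power2_eq_square power3_eq_cube)

lemma a_ge_a_q:
  assumes "0 \<le> \<rho>"
  shows "a q \<le> a \<rho>"
proof -
  \<comment> \<open>Being critical, \<open>q\<close> is a double root of the difference; the third
    root is \<open>- 2 * q\<close>.\<close>
  have "a \<rho> - a q = Re g * ((\<rho> - q)\<^sup>2 * (\<rho> + 2 * q))"
    by (simp add: a_eq algebra_simps power2_eq_square)
  also have "\<dots> \<ge> 0" using assms q g by simp
  finally show ?thesis by simp
qed

lemma a_strict_decreasing:
  assumes "0 \<le> x" "x < y" "y \<le> q"
  shows "a y < a x"
proof -
  have "x\<^sup>2 < q\<^sup>2" "y\<^sup>2 \<le> q\<^sup>2" "x * y \<le> q\<^sup>2"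
    using assms q by (auto simp: power2_eq_square intro: mult_mono mult_strict_mono)
  then have "x\<^sup>2 + x * y + y\<^sup>2 - 3 * q\<^sup>2 < 0" by linarith
  then have "(y - x) * (x\<^sup>2 + x * y + y\<^sup>2 - 3 * q\<^sup>2) < 0"
    using assms(2) by (simp add: mult_pos_neg)
  then have "Re g * ((y - x) * (x\<^sup>2 + x * y + y\<^sup>2 - 3 * q\<^sup>2)) < 0"
    using g by (rule mult_pos_neg[rotated])
  then show ?thesis using a_diff[of y x] by (simp add: mult.assoc)
qed

lemma a_strict_increasing:
  assumes "q \<le> x" "x < y"
  shows "a x < a y"
proof -
  have "q\<^sup>2 \<le> x\<^sup>2" "q\<^sup>2 < y\<^sup>2" "q\<^sup>2 \<le> x * y"
    using assms q by (auto simp: power2_eq_square intro: mult_mono mult_strict_mono)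
  then have "0 < x\<^sup>2 + x * y + y\<^sup>2 - 3 * q\<^sup>2" by linarith
  then have "0 < Re g * (y - x) * (x\<^sup>2 + x * y + y\<^sup>2 - 3 * q\<^sup>2)"
    using assms(2) g by simp
  then show ?thesis using a_diff[of y x] by simp
qed

lemma inj_on_a_low: "inj_on a {0..q}"
proof (rule linorder_inj_onI)
  show "a x \<noteq> a y" if "x < y" "x \<in> {0..q}" "y \<in> {0..q}" for x y
    using a_strict_decreasing[of x y] that by simp
qed auto

lemma inj_on_a_high: "inj_on a {q..}"
proof (rule linorder_inj_onI)
  show "a x \<noteq> a y" if "x < y" "x \<in> {q..}" "y \<in> {q..}" for x y
    using a_strict_increasing[of x y] that by simp
qed auto

section \<open>The level \<open>q\<close> as a barrier for continuation\<close>

lemma FRC_pos: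
  assumes "x \<in> FRC l g c \<epsilon>" "0 < \<epsilon>"
  shows "0 < snd x"
proof -
  obtain \<Omega> \<rho> where x: "x = (\<Omega>, \<rho>)" by fastforce
  then have "0 \<le> \<rho>" "\<rho> \<noteq> 0"
    using assms c by (auto simp: FRC_iff)
  then show ?thesis by (simp add: x)
qed

lemma FRC_snd_ne_q:
  assumes "x \<in> FRC l g c \<epsilon>" "0 \<le> \<epsilon>" "\<epsilon> < crit"
  shows "snd x \<noteq> q"
proof
  assume "snd x = q"
  then have "crit * cmod c \<le> \<epsilon> * cmod c"
    using FRC_abs_a_le[OF assms(1,2)] a_q by simp
  then show False using assms(3) cmod_c by simp
qed

lemma perturbed_branch_low:
  assumes x: "x \<in> perturbed_branch l g c S \<epsilon>" and \<epsilon>: "0 \<le> \<epsilon>" "\<epsilon> \<le> crit"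
    and S: "\<And>y. y \<in> S \<Longrightarrow> snd y \<le> q"
  shows "snd x \<le> q"
proof (rule ccontr)
  assume gt: "\<not> snd x \<le> q"
  obtain p where p: "continuous_on {0..\<epsilon>} p" "\<And>s. s \<in> {0..\<epsilon>} \<Longrightarrow> p s \<in> FRC l g c s"
    "p 0 \<in> S" "p \<epsilon> = x"
    using x by (auto simp: perturbed_branch_def)
  have "\<exists>s\<ge>0. s \<le> \<epsilon> \<and> snd (p s) = q"
    using IVT'[of "\<lambda>s. snd (p s)" 0 q \<epsilon>] S[OF p(3)] gt p(1,4) \<epsilon>(1)
    by (auto intro: continuous_intros)
  then obtain s where s: "0 \<le> s" "s \<le> \<epsilon>" "snd (p s) = q" by blast
  \<comment> \<open>The endpoint lies strictly above the level, so the crossing happens at some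
    \<open>s < crit\<close> even if \<open>\<epsilon> = crit\<close>. This makes the bound available
    at the merging value itself.\<close>
  then have "s \<noteq> \<epsilon>" using gt p(4) by auto
  then show False
    using FRC_snd_ne_q[of "p s" s] p(2)[of s] s \<epsilon> by auto
qed

lemma perturbed_branch_high:
  assumes x: "x \<in> perturbed_branch l g c S \<epsilon>" and \<epsilon>: "0 \<le> \<epsilon>" "\<epsilon> \<le> crit"
    and S: "\<And>y. y \<in> S \<Longrightarrow> q \<le> snd y"
  shows "q \<le> snd x"
proof (rule ccontr)
  assume lt: "\<not> q \<le> snd x"
  obtain p where p: "continuous_on {0..\<epsilon>} p" "\<And>s. s \<in> {0..\<epsilon>} \<Longrightarrow> p s \<in> FRC l g c s"
    "p 0 \<in> S" "p \<epsilon> = x"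
    using x by (auto simp: perturbed_branch_def)
  have "\<exists>s\<ge>0. s \<le> \<epsilon> \<and> snd (p s) = q"
    using IVT2'[of "\<lambda>s. snd (p s)" \<epsilon> q 0] S[OF p(3)] lt p(1,4) \<epsilon>(1)
    by (auto intro: continuous_intros)
  then obtain s where s: "0 \<le> s" "s \<le> \<epsilon>" "snd (p s) = q" by blast
  then have "s \<noteq> \<epsilon>" using lt p(4) by auto
  then show False
    using FRC_snd_ne_q[of "p s" s] p(2)[of s] s \<epsilon> by auto
qed

section \<open>Continuing responses back to zero forcing\<close>

lemma main_FRC_contains_low:
  assumes x: "(\<Omega>, \<rho>) \<in> FRC l g c \<epsilon>" and "0 < \<epsilon>" "\<rho> \<le> q"
  shows "(\<Omega>, \<rho>) \<in> main_FRC l g c \<epsilon>"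
proof -
  have \<rho>: "0 < \<rho>" using FRC_pos[OF x assms(2)] by simp
  have seg: "closed_segment 0 \<rho> = {0..\<rho>}"
    using \<rho> by (simp add: closed_segment_eq_real_ivl)
  obtain r where r: "continuous_on {0..\<epsilon>} r" "r 0 = 0" "r \<epsilon> = \<rho>"
    "\<And>s. s \<in> {0..\<epsilon>} \<Longrightarrow> r s \<in> closed_segment 0 \<rho> \<and> a (r s) = s / \<epsilon> * a \<rho>"
    using assms(2,3) inj_on_subset[OF inj_on_a_low, of "{0..\<rho>}"]
    by (metis seg lift_through_injective[of 0 \<rho> a \<epsilon>] continuous_on_a_cubic a_0 atLeastatMost_subset_iff
        order_refl)
  \<comment> \<open>A polynomial extension of \<open>- a \<rho> / \<rho>\<close> to amplitude 0; it
    is positive at the given response because \<open>\<rho> \<le> q\<close>.\<close>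
  define k where "k \<rho> = Re g * (3 * q\<^sup>2 - \<rho>\<^sup>2)" for \<rho>
  have k: "k \<rho> * \<rho> = - a \<rho>" for \<rho> by (simp add: k_def a_eq algebra_simps)
  have "\<rho>\<^sup>2 \<le> q\<^sup>2" using \<rho> assms(3) by (simp add: power_mono)
  moreover have "0 < q\<^sup>2" using q by simp
  ultimately have "0 < 3 * q\<^sup>2 - \<rho>\<^sup>2" by linarith
  then have k_pos: "0 < k \<rho>" using g unfolding k_def by (rule mult_pos_pos[rotated])
  txt \<open>Along the path \<open>(\<Omega> - b) \<rho>\<close> and \<open>a\<close> keep their ratio; dividing both by \<open>\<rho>\<close> makes the formula
    for \<open>\<Omega>\<close> meaningful at \<open>\<rho> = 0\<close>.\<close>
  define t where "t = (\<Omega> - b \<rho>) / k \<rho>"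
  define p where "p s = (b (r s) + t * k (r s), r s)" for s
  have "continuous_on {0..\<epsilon>} p"
    unfolding p_def k_def b_cubic_def using r(1) by (intro continuous_intros)
  moreover have "p s \<in> FRC l g c s" if s: "s \<in> {0..\<epsilon>}" for s
  proof -
    define m where "m = s / \<epsilon>"
    have as: "a (r s) = m * a \<rho>" "0 \<le> r s" using r(4)[OF s] seg by (auto simp: m_def)
    have "t * k (r s) * r s = t * (k (r s) * r s)" by simp
    also have "\<dots> = m * (t * k \<rho> * \<rho>)"
      unfolding mult.assoc[of t] k as(1) by simp
    also have "\<dots> = m * ((\<Omega> - b \<rho>) * \<rho>)"
      using k_pos by (simp add: t_def)
    finally have w: "t * k (r s) * r s = m * ((\<Omega> - b \<rho>) * \<rho>)" .
    have "(a (r s))\<^sup>2 + (- (t * k (r s) * r s))\<^sup>2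
        = m\<^sup>2 * ((a \<rho>)\<^sup>2 + ((b \<rho> - \<Omega>) * \<rho>)\<^sup>2)"
      unfolding as(1) w by (simp add: power2_eq_square algebra_simps)
    also have "\<dots> = (m * \<epsilon> * cmod c)\<^sup>2"
      using x by (simp add: FRC_iff power_mult_distrib)
    also have "m * \<epsilon> = s" using assms(2) by (simp add: m_def)
    finally show ?thesis using as(2) by (simp add: p_def FRC_iff)
  qed
  \<comment> \<open>The starting frequency \<open>b 0 + t * k 0\<close> depends on the response;
    this is harmless since the trivial solution occupies the whole line
    \<open>\<rho> = 0\<close>.\<close>
  moreover have "p 0 \<in> {(\<Omega>, \<rho>). \<rho> = 0}" "p \<epsilon> = (\<Omega>, \<rho>)"
    using r(2,3) k_pos by (simp_all add: p_def t_def)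
  ultimately show ?thesis
    unfolding main_FRC_def by (rule perturbed_branchI)
qed

text \<open>\<open>sqrt 3 * q\<close> is the amplitude \<open>\<rho>\<^sub>1\<close>.\<close>

lemma a_backbone: "a (sqrt 3 * q) = 0"
  by (simp add: a_eq power_mult_distrib)

lemma q_le_backbone: "q \<le> sqrt 3 * q"
  using q by simp

lemma backbone_branch_contains_high:
  assumes x: "(\<Omega>, \<rho>) \<in> FRC l g c \<epsilon>" and "0 < \<epsilon>" "q \<le> \<rho>"
  shows "(\<Omega>, \<rho>) \<in> backbone_branch l g c (sqrt 3 * q) \<epsilon>"
proof -
  have seg: "closed_segment (sqrt 3 * q) \<rho> \<subseteq> {q..}"
    using assms(3) q_le_backbone by (auto simp: closed_segment_eq_real_ivl split: if_splits)
  obtain r where r: "continuous_on {0..\<epsilon>} r" "r 0 = sqrt 3 * q" "r \<epsilon> = \<rho>"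
    "\<And>s. s \<in> {0..\<epsilon>} \<Longrightarrow> r s \<in> closed_segment (sqrt 3 * q) \<rho> \<and> a (r s) = s / \<epsilon> * a \<rho>"
    using lift_through_injective[OF continuous_on_a_cubic inj_on_subset[OF inj_on_a_high seg]
        a_backbone assms(2)] by blast
  have r_pos: "0 < r s" if "s \<in> {0..\<epsilon>}" for s
    using r(4)[OF that] seg q by auto
  \<comment> \<open>Amplitudes stay above \<open>q\<close>, so the scaled value of
    \<open>(\<Omega> - b \<rho>) * \<rho>\<close> can be divided by \<open>r s\<close> directly. The
    correction vanishes at \<open>s = 0\<close>, which leaves the backbone point.\<close>
  define p where "p s = (b (r s) + s / \<epsilon> * ((\<Omega> - b \<rho>) * \<rho>) / r s, r s)" for s
  have "continuous_on {0..\<epsilon>} p"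
    unfolding p_def b_cubic_def using r(1) r_pos assms(2)
    by (intro continuous_intros) (auto simp: less_imp_neq[symmetric])
  moreover have "p s \<in> FRC l g c s" if s: "s \<in> {0..\<epsilon>}" for s
  proof -
    define m where "m = s / \<epsilon>"
    have as: "a (r s) = m * a \<rho>" using r(4)[OF s] by (simp add: m_def)
    have "(a (r s))\<^sup>2 + (- (m * ((\<Omega> - b \<rho>) * \<rho>)))\<^sup>2
        = m\<^sup>2 * ((a \<rho>)\<^sup>2 + ((b \<rho> - \<Omega>) * \<rho>)\<^sup>2)"
      unfolding as by (simp add: power2_eq_square algebra_simps)
    also have "\<dots> = (m * \<epsilon> * cmod c)\<^sup>2"
      using x by (simp add: FRC_iff power_mult_distrib)
    also have "m * \<epsilon> = s" using assms(2) by (simp add: m_def)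
    finally show ?thesis using r_pos[OF s] by (simp add: p_def FRC_iff flip: m_def)
  qed
  moreover have "p 0 \<in> {(b (sqrt 3 * q), sqrt 3 * q)}" "p \<epsilon> = (\<Omega>, \<rho>)"
    using r(2,3) assms(2,3) q by (simp_all add: p_def)
  ultimately show ?thesis
    unfolding backbone_branch_def by (rule perturbed_branchI)
qed

text \<open>Each amplitude lies on one side of \<open>q\<close>, so one of the two continuations
  reaches it. The identity covers every positive forcing and thus also serves above
  \<open>crit\<close>.\<close>

lemma main_un_backbone:
  assumes "0 < \<epsilon>"
  shows "main_FRC l g c \<epsilon> \<union> backbone_branch l g c (sqrt 3 * q) \<epsilon> = FRC l g c \<epsilon>"
proof
  show "main_FRC l g c \<epsilon> \<union> backbone_branch l g c (sqrt 3 * q) \<epsilon> \<subseteq> FRC l g c \<epsilon>"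
    using perturbed_branch_subset_FRC assms by (simp add: main_FRC_def backbone_branch_def)
  show "FRC l g c \<epsilon> \<subseteq> main_FRC l g c \<epsilon> \<union> backbone_branch l g c (sqrt 3 * q) \<epsilon>"
    using main_FRC_contains_low[OF _ assms] backbone_branch_contains_high[OF _ assms]
    by (metis UnCI linear subrelI)
qed

lemma main_FRC_eq:
  assumes "0 < \<epsilon>" "\<epsilon> \<le> crit"
  shows "main_FRC l g c \<epsilon> = {x \<in> FRC l g c \<epsilon>. snd x \<le> q}"
proof -
  have "snd x \<le> q" if "x \<in> main_FRC l g c \<epsilon>" for x
    using that[unfolded main_FRC_def]
    by (rule perturbed_branch_low) (use assms q in auto)
  then show ?thesis
    using main_un_backbone[OF assms(1)] main_FRC_contains_low[OF _ assms(1)] by auto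
qed

lemma backbone_branch_eq:
  assumes "0 < \<epsilon>" "\<epsilon> \<le> crit"
  shows "backbone_branch l g c (sqrt 3 * q) \<epsilon> = {x \<in> FRC l g c \<epsilon>. q \<le> snd x}"
proof -
  have "q \<le> snd x" if "x \<in> backbone_branch l g c (sqrt 3 * q) \<epsilon>" for x
    using that[unfolded backbone_branch_def]
    by (rule perturbed_branch_high) (use assms q_le_backbone in auto)
  then show ?thesis
    using main_un_backbone[OF assms(1)] backbone_branch_contains_high[OF _ assms(1)] by auto
qed

section \<open>Connectedness of the pieces of the curve\<close>

lemma ex_high_amplitude:
  assumes "0 < \<epsilon>"
  shows "\<exists>\<rho>\<ge>q. a \<rho> = \<epsilon> * cmod c"
proof -
  define E where "E = \<epsilon> * cmod c"
  \<comment> \<open>From \<open>R \<ge> 2 * q\<close> follows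
    \<open>R\<^sup>2 - 3 * q\<^sup>2 \<ge> q\<^sup>2\<close>, so
    \<open>a R \<ge> Re g * R * q\<^sup>2\<close>; the second summand lifts this bound to
    \<open>E\<close>.\<close>
  define R where "R = 2 * q + E / (Re g * q\<^sup>2)"
  have E: "0 < E" using assms cmod_c by (simp add: E_def)
  have R: "2 * q \<le> R" using E g q by (simp add: R_def)
  have "E \<le> Re g * R * q\<^sup>2"
    using g q by (simp add: R_def field_simps)
  also have "\<dots> \<le> a R"
  proof -
    have "(2 * q)\<^sup>2 \<le> R\<^sup>2" using R q by (intro power_mono) auto
    then show ?thesis unfolding a_eq using g q R by (intro mult_left_mono) (auto simp: power_mult_distrib)
  qed
  finally have "\<exists>\<rho>\<ge>q. \<rho> \<le> R \<and> a \<rho> = E"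
    using E R q a_q crit_pos cmod_c
    by (intro IVT' continuous_on_a_cubic) (auto intro: order_trans[of _ 0])
  then show ?thesis by (auto simp: E_def)
qed

lemma ex_low_amplitude:
  assumes "0 < \<epsilon>" "\<epsilon> \<le> crit"
  shows "\<exists>\<rho>. 0 < \<rho> \<and> \<rho> \<le> q \<and> a \<rho> = - (\<epsilon> * cmod c)"
proof -
  have "\<exists>\<rho>\<ge>0. \<rho> \<le> q \<and> a \<rho> = - (\<epsilon> * cmod c)"
    using assms q cmod_c a_q
    by (intro IVT2' continuous_on_a_cubic) auto
  moreover have "a 0 \<noteq> - (\<epsilon> * cmod c)" using assms(1) c by simp
  ultimately show ?thesis by (metis less_eq_real_def)
qed

text \<open>Monotonicity of \<open>a\<close> makes the admissible amplitudes an interval. The two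
  graphs over it join at its top, where \<open>a\<close> equals
  \<open>- (\<epsilon> * cmod c)\<close>.\<close>

lemma connected_low:
  assumes "0 < \<epsilon>" "\<epsilon> \<le> crit"
  shows "connected {x \<in> FRC l g c \<epsilon>. snd x \<le> q}"
proof -
  let ?J = "{\<rho>. 0 < \<rho> \<and> \<rho> \<le> q \<and> \<bar>a \<rho>\<bar> \<le> \<epsilon> * cmod c}"
  have dec: "a y \<le> a x" if "0 \<le> x" "x \<le> y" "y \<le> q" for x y
    using a_strict_decreasing[of x y] that by force
  obtain t where "0 < t" "t \<le> q" "a t = - (\<epsilon> * cmod c)"
    using ex_low_amplitude[OF assms] by blast
  moreover have "is_interval ?J"
    unfolding is_interval_1
  proof (intro ballI allI impI)
    fix x y z assume "x \<in> ?J" "y \<in> ?J" "x \<le> z \<and> z \<le> y"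
    then show "z \<in> ?J"
      using dec[of x z] dec[of z y] by auto
  qed
  ultimately have "connected {x \<in> FRC l g c \<epsilon>. snd x \<in> ?J}"
    using assms(1) by (intro connected_FRC_strip[of _ _ _ _ _ t]) auto
  also have "{x \<in> FRC l g c \<epsilon>. snd x \<in> ?J} = {x \<in> FRC l g c \<epsilon>. snd x \<le> q}"
    using FRC_pos[OF _ assms(1)] FRC_abs_a_le assms(1) by fastforce
  finally show ?thesis .
qed

text \<open>On the increasing part the graphs join where \<open>a\<close> equals
  \<open>\<epsilon> * cmod c\<close>, an amplitude that exists for every positive forcing.\<close>

lemma connected_high:
  assumes "0 < \<epsilon>"
  shows "connected {x \<in> FRC l g c \<epsilon>. q \<le> snd x}"
proof -
  let ?J = "{\<rho>. q \<le> \<rho> \<and> \<bar>a \<rho>\<bar> \<le> \<epsilon> * cmod c}"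
  have inc: "a x \<le> a y" if "q \<le> x" "x \<le> y" for x y
    using a_strict_increasing[of x y] that by force
  obtain t where "q \<le> t" "a t = \<epsilon> * cmod c"
    using ex_high_amplitude[OF assms] by blast
  moreover have "is_interval ?J"
    unfolding is_interval_1
  proof (intro ballI allI impI)
    fix x y z assume "x \<in> ?J" "y \<in> ?J" "x \<le> z \<and> z \<le> y"
    then show "z \<in> ?J"
      using inc[of x z] inc[of z y] by auto
  qed
  ultimately have "connected {x \<in> FRC l g c \<epsilon>. snd x \<in> ?J}"
    using assms q by (intro connected_FRC_strip[of _ _ _ _ _ t]) auto
  also have "{x \<in> FRC l g c \<epsilon>. snd x \<in> ?J} = {x \<in> FRC l g c \<epsilon>. q \<le> snd x}"
    using FRC_abs_a_le assms by fastforce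
  finally show ?thesis .
qed

text \<open>From \<open>crit\<close> on, the minimum of \<open>a\<close> no longer violates the
  lower bound. The upper bound holds up to \<open>q\<close> because \<open>a\<close> is negative
  there, and beyond \<open>q\<close> it is inherited by smaller amplitudes, so all admissible
  amplitudes form one interval.\<close>

lemma connected_FRC:
  assumes "crit \<le> \<epsilon>"
  shows "connected (FRC l g c \<epsilon>)"
proof -
  have \<epsilon>: "0 < \<epsilon>" using assms crit_pos by simp
  have lower: "- (\<epsilon> * cmod c) \<le> a \<rho>" if "0 \<le> \<rho>" for \<rho>
    using a_ge_a_q[OF that] a_q mult_right_mono[OF assms, of "cmod c"] by simp
  let ?J = "{\<rho>. 0 < \<rho> \<and> \<bar>a \<rho>\<bar> \<le> \<epsilon> * cmod c}"
  obtain t where "q \<le> t" "a t = \<epsilon> * cmod c"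
    using ex_high_amplitude[OF \<epsilon>] by blast
  moreover have "is_interval ?J"
    unfolding is_interval_1
  proof (intro ballI allI impI)
    fix x y z assume "x \<in> ?J" "y \<in> ?J" "x \<le> z \<and> z \<le> y"
    then have *: "0 < x" "x \<le> z" "z \<le> y" "\<bar>a y\<bar> \<le> \<epsilon> * cmod c" by auto
    have "a z \<le> \<epsilon> * cmod c"
    proof (cases "z \<le> q")
      case True
      then have "a z < a 0" using * by (intro a_strict_decreasing) auto
      then show ?thesis using \<epsilon> by (simp add: order.trans[of _ 0])
    next
      case False
      then show ?thesis using a_strict_increasing[of z y] * by force
    qed
    then show "z \<in> ?J"
      using lower[of z] * by auto
  qed
  ultimately have "connected {x \<in> FRC l g c \<epsilon>. snd x \<in> ?J}"
    using \<epsilon> q by (intro connected_FRC_strip[of _ _ _ _ _ t]) auto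
  also have "{x \<in> FRC l g c \<epsilon>. snd x \<in> ?J} = FRC l g c \<epsilon>"
    using FRC_pos[OF _ \<epsilon>] FRC_abs_a_le \<epsilon> by fastforce
  finally show ?thesis .
qed

section \<open>Separation below the merging value\<close>

text \<open>On the backbone the second square vanishes. These points show that both parts are
  nonempty and, at amplitude \<open>q\<close>, that they touch.\<close>

lemma FRC_backbone_point:
  assumes "0 < \<rho>" "\<bar>a \<rho>\<bar> = \<epsilon> * cmod c"
  shows "(b \<rho>, \<rho>) \<in> FRC l g c \<epsilon>"
  using assms by (simp add: FRC_iff flip: assms(2))

text \<open>No response has amplitude \<open>q\<close>, so the closed half-planes on the two sides
  of this level separate the curve into its two connected parts.\<close>

lemma subcritical:
  assumes "0 < \<epsilon>" "\<epsilon> < crit"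
  shows "main_FRC l g c \<epsilon> \<in> components (FRC l g c \<epsilon>)"
    and "is_isola l g c \<epsilon> (backbone_branch l g c (sqrt 3 * q) \<epsilon>)"
    and "\<not> connected (main_FRC l g c \<epsilon> \<union> backbone_branch l g c (sqrt 3 * q) \<epsilon>)"
proof -
  let ?low = "{x \<in> FRC l g c \<epsilon>. snd x \<le> q}" and ?high = "{x \<in> FRC l g c \<epsilon>. q \<le> snd x}"
  let ?U = "{x :: real \<times> real. snd x \<le> q}" and ?V = "{x :: real \<times> real. q \<le> snd x}"
  have eqs: "main_FRC l g c \<epsilon> = ?low" "backbone_branch l g c (sqrt 3 * q) \<epsilon> = ?high"
    using main_FRC_eq backbone_branch_eq assms by auto
  have disj: "FRC l g c \<epsilon> \<inter> ?U \<inter> ?V = {}" "FRC l g c \<epsilon> \<inter> ?V \<inter> ?U = {}"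
    using FRC_snd_ne_q[of _ \<epsilon>] assms by force+
  have closed: "closed ?U" "closed ?V"
    by (intro closed_Collect_le continuous_intros)+
  obtain t where "0 < t" "t \<le> q" "a t = - (\<epsilon> * cmod c)"
    using ex_low_amplitude assms by force
  then have low: "?low \<noteq> {}"
    using FRC_backbone_point[of t \<epsilon>] assms by force
  obtain t where "q \<le> t" "a t = \<epsilon> * cmod c"
    using ex_high_amplitude assms by force
  then have high: "?high \<noteq> {}"
    using FRC_backbone_point[of t \<epsilon>] assms q by force
  have un: "FRC l g c \<epsilon> = ?low \<union> ?high" "FRC l g c \<epsilon> = ?high \<union> ?low" by auto
  show "main_FRC l g c \<epsilon> \<in> components (FRC l g c \<epsilon>)"
    unfolding eqs using assms
    by (intro component_of_separated_parts[OF un(1) low connected_low closed _ _ disj(1)]) auto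
  have "?high \<in> components (FRC l g c \<epsilon>)"
    using assms
    by (intro component_of_separated_parts[OF un(2) high connected_high closed(2,1) _ _ disj(2)]) auto
  then show "is_isola l g c \<epsilon> (backbone_branch l g c (sqrt 3 * q) \<epsilon>)"
    unfolding is_isola_def eqs using disj by blast
  have "FRC l g c \<epsilon> \<subseteq> ?U \<union> ?V" by auto
  moreover have "?U \<inter> ?V \<inter> FRC l g c \<epsilon> = {}"
    "?U \<inter> FRC l g c \<epsilon> \<noteq> {}" "?V \<inter> FRC l g c \<epsilon> \<noteq> {}"
    using disj(1) low high by blast+
  ultimately have "\<not> connected (FRC l g c \<epsilon>)"
    unfolding connected_closed not_not using closed by metis
  then show "\<not> connected (main_FRC l g c \<epsilon> \<union> backbone_branch l g c (sqrt 3 * q) \<epsilon>)"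
    using main_un_backbone assms by simp
qed

section \<open>Localization of the isola\<close>

text \<open>Each estimate divides out a factor that is at least \<open>q\<close>: first
  \<open>\<rho>\<close> in the factored form of \<open>a\<close>, then
  \<open>\<rho> + sqrt 3 * q\<close> in the difference of squares. The squared version controls
  \<open>b\<close>.\<close>

lemma high_amplitude_near_backbone:
  assumes "q \<le> \<rho>" "\<bar>a \<rho>\<bar> \<le> E"
  shows "\<bar>\<rho>\<^sup>2 - (sqrt 3 * q)\<^sup>2\<bar> \<le> E / (Re g * q)" and "\<bar>\<rho> - sqrt 3 * q\<bar> \<le> E / (Re g * q\<^sup>2)"
proof -
  have "Re g * q * \<bar>\<rho>\<^sup>2 - (sqrt 3 * q)\<^sup>2\<bar> \<le> Re g * \<rho> * \<bar>\<rho>\<^sup>2 - (sqrt 3 * q)\<^sup>2\<bar>"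
    using assms(1) g by (intro mult_right_mono mult_left_mono) auto
  also have "\<dots> = \<bar>a \<rho>\<bar>"
    using assms(1) g q by (simp add: a_eq abs_mult power_mult_distrib)
  finally have *: "Re g * q * \<bar>\<rho>\<^sup>2 - (sqrt 3 * q)\<^sup>2\<bar> \<le> E" using assms(2) by simp
  then show "\<bar>\<rho>\<^sup>2 - (sqrt 3 * q)\<^sup>2\<bar> \<le> E / (Re g * q)"
    using g q by (simp add: field_simps)
  have "q * \<bar>\<rho> - sqrt 3 * q\<bar> \<le> (\<rho> + sqrt 3 * q) * \<bar>\<rho> - sqrt 3 * q\<bar>"
    using assms(1) q_le_backbone q by (intro mult_right_mono) linarith+
  also have "\<dots> = \<bar>\<rho>\<^sup>2 - (sqrt 3 * q)\<^sup>2\<bar>"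
  proof -
    have "\<rho>\<^sup>2 - (sqrt 3 * q)\<^sup>2 = (\<rho> + sqrt 3 * q) * (\<rho> - sqrt 3 * q)"
      by (simp add: power2_eq_square algebra_simps)
    then show ?thesis using assms(1) q by (simp add: abs_mult)
  qed
  finally have "Re g * q * (q * \<bar>\<rho> - sqrt 3 * q\<bar>) \<le> E"
    using * g q mult_left_mono[of _ _ "Re g * q"] by (smt (verit) mult_pos_pos)
  then show "\<bar>\<rho> - sqrt 3 * q\<bar> \<le> E / (Re g * q\<^sup>2)"
    using g q by (simp add: field_simps power2_eq_square)
qed

lemma backbone_branch_near:
  obtains K where "0 < K"
    "\<And>\<epsilon> x. \<lbrakk>0 < \<epsilon>; \<epsilon> \<le> crit; x \<in> backbone_branch l g c (sqrt 3 * q) \<epsilon>\<rbrakk>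
       \<Longrightarrow> dist (b (sqrt 3 * q), sqrt 3 * q) x \<le> K * \<epsilon>"
proof
  \<comment> \<open>The summands account, in order, for the distance of \<open>\<Omega>\<close> from
    \<open>b \<rho>\<close>, the change of \<open>b\<close> between \<open>\<rho>\<close> and the
    backbone amplitude, and the amplitude error.\<close>
  define K where "K = (1 / q + \<bar>Im g\<bar> / (Re g * q) + 1 / (Re g * q\<^sup>2)) * cmod c"
  show "0 < K"
    using g q cmod_c unfolding K_def by (intro mult_pos_pos add_pos_pos add_pos_nonneg) auto
  fix \<epsilon> x assume *: "0 < \<epsilon>" "\<epsilon> \<le> crit" "x \<in> backbone_branch l g c (sqrt 3 * q) \<epsilon>"
  define E where "E = \<epsilon> * cmod c"
  have E: "0 < E" using * cmod_c by (simp add: E_def)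
  obtain \<Omega> \<rho> where x: "x = (\<Omega>, \<rho>)" by fastforce
  have mem: "(\<Omega>, \<rho>) \<in> FRC l g c \<epsilon>" "q \<le> \<rho>"
    using * backbone_branch_eq x by auto
  then have near: "\<bar>\<rho>\<^sup>2 - (sqrt 3 * q)\<^sup>2\<bar> \<le> E / (Re g * q)" "\<bar>\<rho> - sqrt 3 * q\<bar> \<le> E / (Re g * q\<^sup>2)"
    using high_amplitude_near_backbone[of \<rho> E] FRC_abs_a_le[OF mem(1)] * by (auto simp: E_def)
  have "((b \<rho> - \<Omega>) * \<rho>)\<^sup>2 \<le> E\<^sup>2"
    using mem(1) by (simp add: FRC_iff E_def) (smt (verit) zero_le_power2)
  then have "\<bar>(b \<rho> - \<Omega>) * \<rho>\<bar> \<le> E"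
    using E by (simp add: abs_le_square_iff[symmetric])
  moreover have "\<bar>b \<rho> - \<Omega>\<bar> * q \<le> \<bar>(b \<rho> - \<Omega>) * \<rho>\<bar>"
    using mem(2) q by (simp add: abs_mult mult_left_mono)
  ultimately have "\<bar>b \<rho> - \<Omega>\<bar> \<le> E / q"
    using q by (simp add: field_simps)
  moreover have "\<bar>b (sqrt 3 * q) - b \<rho>\<bar> \<le> \<bar>Im g\<bar> * (E / (Re g * q))"
  proof -
    have "b \<rho> - b (sqrt 3 * q) = Im g * (\<rho>\<^sup>2 - (sqrt 3 * q)\<^sup>2)"
      by (simp add: b_cubic_def algebra_simps)
    then show ?thesis
      using mult_left_mono[OF near(1), of "\<bar>Im g\<bar>"] by (simp add: abs_minus_commute abs_mult)
  qed
  moreover have "dist (b (sqrt 3 * q), sqrt 3 * q) x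
      \<le> \<bar>b (sqrt 3 * q) - \<Omega>\<bar> + \<bar>sqrt 3 * q - \<rho>\<bar>"
    unfolding x dist_Pair_Pair dist_real_def using sqrt_sum_squares_le_sum_abs by (metis abs_abs)
  ultimately have "dist (b (sqrt 3 * q), sqrt 3 * q) x
      \<le> E / q + \<bar>Im g\<bar> * (E / (Re g * q)) + E / (Re g * q\<^sup>2)"
    using near(2) by linarith
  also have "\<dots> = K * \<epsilon>"
    by (simp add: K_def E_def algebra_simps add_divide_distrib)
  finally show "dist (b (sqrt 3 * q), sqrt 3 * q) x \<le> K * \<epsilon>" .
qed

end

section \<open>Isola, separation and merging in the original parameters\<close>

theorem theorem5:
  fixes l c :: complex and \<gamma> :: "nat \<Rightarrow> complex" and \<rho>\<^sub>1 \<epsilon>\<^sub>m :: real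
    and main isola :: "real \<Rightarrow> (real \<times> real) set"
  assumes "Re l < 0" and "c \<noteq> 0" and "Re (\<gamma> 1) > 0"
    and "\<rho>\<^sub>1 = sqrt (\<bar>Re l\<bar> / Re (\<gamma> 1))"
    and "nonspurious_zero l \<gamma> 1 \<rho>\<^sub>1"
    and "\<epsilon>\<^sub>m = 1 / cmod c * sqrt (4 * \<bar>Re l\<bar> ^ 3 / (27 * Re (\<gamma> 1)))"
    and "main = main_FRC l (\<gamma> 1) c"
    and "isola = backbone_branch l (\<gamma> 1) c \<rho>\<^sub>1"
  shows "((\<exists>\<epsilon>\<^sub>0>0. \<forall>\<epsilon>. 0 < \<epsilon> \<and> \<epsilon> < \<epsilon>\<^sub>0 \<longrightarrow> is_isola l (\<gamma> 1) c \<epsilon> (isola \<epsilon>)) \<and>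
          (\<forall>\<delta>>0. \<exists>\<epsilon>\<^sub>0>0. \<forall>\<epsilon>. 0 < \<epsilon> \<and> \<epsilon> < \<epsilon>\<^sub>0 \<longrightarrow>
             isola \<epsilon> \<subseteq> ball (b_cubic l (\<gamma> 1) \<rho>\<^sub>1, \<rho>\<^sub>1) \<delta>)) \<and>
         (\<forall>\<epsilon>. 0 < \<epsilon> \<and> \<epsilon> < \<epsilon>\<^sub>m \<longrightarrow>
            main \<epsilon> \<in> components (FRC l (\<gamma> 1) c \<epsilon>) \<and> is_isola l (\<gamma> 1) c \<epsilon> (isola \<epsilon>)) \<and>
         ((\<forall>\<epsilon>>0. connected (main \<epsilon> \<union> isola \<epsilon>) \<longleftrightarrow> \<epsilon>\<^sub>m \<le> \<epsilon>) \<and>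
          (\<exists>\<Omega> \<rho>. (\<Omega>, \<rho>) \<in> main \<epsilon>\<^sub>m \<inter> isola \<epsilon>\<^sub>m \<and>
             (\<forall>x\<in>main \<epsilon>\<^sub>m. snd x \<le> \<rho>) \<and> (\<forall>x\<in>isola \<epsilon>\<^sub>m. \<rho> \<le> snd x)))"
proof -
  txt \<open>Otherwise \<open>\<gamma> 1\<close> becomes \<open>\<gamma> (Suc 0)\<close> and no longer matches the facts of the interpretation.\<close>
  note One_nat_def [simp del]
  define q where "q = sqrt (\<bar>Re l\<bar> / (3 * Re (\<gamma> 1)))"
  have q2: "q\<^sup>2 = \<bar>Re l\<bar> / (3 * Re (\<gamma> 1))"
    using assms(3) by (simp add: q_def)
  interpret cubic_response l "\<gamma> 1" c q
  proof
    show "0 < q"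
      using assms(1,3) unfolding q_def by (intro real_sqrt_gt_zero divide_pos_pos) auto
    show "Re l = - 3 * Re (\<gamma> 1) * q\<^sup>2"
      using assms(1,3) by (simp add: q2)
  qed (use assms in auto)
  have \<rho>1: "\<rho>\<^sub>1 = sqrt 3 * q"
    using assms(3) by (simp add: assms(4) q_def flip: real_sqrt_mult)
  \<comment> \<open>Taking square roots here identifies \<open>\<epsilon>\<^sub>m\<close> with
    \<open>crit\<close>.\<close>
  have "4 * \<bar>Re l\<bar> ^ 3 / (27 * Re (\<gamma> 1)) = (2 * Re (\<gamma> 1) * q ^ 3)\<^sup>2"
  proof -
    have "(2 * Re (\<gamma> 1) * q ^ 3)\<^sup>2 = 4 * (Re (\<gamma> 1))\<^sup>2 * (q\<^sup>2) ^ 3"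
      by (simp add: power_mult_distrib flip: power_mult)
    moreover have "4 * r\<^sup>2 * (x / (3 * r)) ^ 3 = 4 * x ^ 3 / (27 * r)" if "0 < r" for r x :: real
      using that by (simp add: field_simps power2_eq_square power3_eq_cube)
    ultimately show ?thesis
      using assms(3) by (simp only: q2)
  qed
  then have crit_eq: "\<epsilon>\<^sub>m = cubic_response.crit (\<gamma> 1) c q"
    using assms(3) q by (simp add: assms(6) crit_def)
  note defs = assms(7,8) \<rho>1 crit_eq
  have small: "\<exists>\<epsilon>\<^sub>0>0. \<forall>\<epsilon>. 0 < \<epsilon> \<and> \<epsilon> < \<epsilon>\<^sub>0 \<longrightarrow> isola \<epsilon> \<subseteq> ball (b \<rho>\<^sub>1, \<rho>\<^sub>1) \<delta>" if \<delta>: "0 < \<delta>" for \<delta>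
  proof -
    obtain K where K: "0 < K"
      "\<And>\<epsilon> x. \<lbrakk>0 < \<epsilon>; \<epsilon> \<le> \<epsilon>\<^sub>m; x \<in> isola \<epsilon>\<rbrakk> \<Longrightarrow> dist (b \<rho>\<^sub>1, \<rho>\<^sub>1) x \<le> K * \<epsilon>"
      unfolding defs using backbone_branch_near by blast
    \<comment> \<open>The first bound on \<open>\<epsilon>\<close> makes the linear estimate
      applicable, the second makes it smaller than \<open>\<delta>\<close>.\<close>
    have "dist (b \<rho>\<^sub>1, \<rho>\<^sub>1) x < \<delta>" if "0 < \<epsilon>" "\<epsilon> < min \<epsilon>\<^sub>m (\<delta> / K)" "x \<in> isola \<epsilon>" for \<epsilon> x
    proof -
      have "K * \<epsilon> < \<delta>" using that K(1) by (simp add: field_simps)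
      then show ?thesis using K(2)[of \<epsilon> x] that by simp
    qed
    moreover have "0 < min \<epsilon>\<^sub>m (\<delta> / K)" using \<delta> K(1) crit_pos crit_eq by simp
    ultimately show ?thesis by (metis mem_ball subsetI)
  qed
  have sub: "main \<epsilon> \<in> components (FRC l (\<gamma> 1) c \<epsilon>) \<and> is_isola l (\<gamma> 1) c \<epsilon> (isola \<epsilon>)
      \<and> \<not> connected (main \<epsilon> \<union> isola \<epsilon>)" if "0 < \<epsilon>" "\<epsilon> < \<epsilon>\<^sub>m" for \<epsilon>
    using that subcritical[of \<epsilon>] unfolding defs by simp
  have super: "connected (main \<epsilon> \<union> isola \<epsilon>)" if "\<epsilon>\<^sub>m \<le> \<epsilon>" for \<epsilon>
    using that connected_FRC[of \<epsilon>] main_un_backbone[of \<epsilon>] crit_pos unfolding defs by simp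
  have pos: "0 < \<epsilon>\<^sub>m" using crit_pos crit_eq by simp
  \<comment> \<open>At \<open>\<epsilon>\<^sub>m\<close> the radius equals \<open>- a q\<close>, so
    the backbone point of amplitude \<open>q\<close> is a response: the top of the main branch and
    the bottom of the isola.\<close>
  have "(b q, q) \<in> FRC l (\<gamma> 1) c \<epsilon>\<^sub>m"
    using FRC_backbone_point[of q] q a_q pos crit_eq by simp
  then have merge: "(b q, q) \<in> main \<epsilon>\<^sub>m \<inter> isola \<epsilon>\<^sub>m \<and>
      (\<forall>x\<in>main \<epsilon>\<^sub>m. snd x \<le> q) \<and> (\<forall>x\<in>isola \<epsilon>\<^sub>m. q \<le> snd x)"
    using main_FRC_eq backbone_branch_eq crit_pos unfolding defs by simp
  \<comment> \<open>For the existence claim in (i), \<open>\<epsilon>\<^sub>m\<close> itself serves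
    as the threshold.\<close>
  show ?thesis
    using small sub super pos merge by (meson linorder_not_less)
qed

end
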